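(* Let $f$ be a developable tube of a regular curve $\gamma=\gamma(s)$ in $S^3$. Then $f$ is self-dual if and only if $|\tau(s)|=1$, where $\tau$ is the torsion of $\gamma$.
   Context: $S^3\subset\mathbb{R}^4$ is the unit sphere. The curve $\gamma:\mathbb{R}\to S^3$ is a complete regular curve parametrized by arclength. Its curvature $\kappa$ and torsion $\tau$ are the functions in the Frenet–Serret formula $e'=-\gamma+\kappa n$, $n'=-\kappa e+\tau b$, $b'=-\tau n$, where $e=\gamma'$ and $(\gamma,e,n,b)$ is the orthonormal Frenet frame of $\mathbb{R}^4$ along $\gamma$ ($n$ principal normal, $b$ binormal). The developable tube (tube of radius $\pi/2$) of $\gamma$ is $f:\mathbb{R}\times S^1\to S^3$, $f(s,t)=(\cos t)e_1(s)+(\sin t)e_2(s)$, where $e_1(s),e_2(s)$ is a smooth orthonormal frame of the orthogonal complement of $\mathrm{span}\{\gamma(s),\gamma'(s)\}$ in $\mathbb{R}^4$. A ruled surface in $S^3$ is a map $f(s,t)=(\cos t)p(s)+(\sin t)v(s)$ with $p(s),v(s)$ orthonormal in $\mathbb{R}^4$; its dual is $f^\#(s,t)=(\cos t)q(s)+(\sin t)w(s)$, where $(p,v,q,w)$ is an $SO(4)$-valued (orthonormal) frame, so that each ruling great circle is replaced by the great circle in the orthogonal 2-plane. A ruled surface is called self-dual if it is congruent (by an isometry of $S^3$) to its dual. *)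

theory Defs
  imports "HOL-Analysis.Analysis"
begin

abbreviation S3 :: "(real^4) set"
  where "S3 \<equiv> sphere 0 1"

definition smooth :: "(real \<Rightarrow> 'a::real_normed_vector) \<Rightarrow> bool"
  where "smooth c \<longleftrightarrow>
    (\<forall>k s. ((\<lambda>g u. vector_derivative g (at u)) ^^ k) c differentiable (at s))"

text \<open>Curves are defined on all of the real line and parametrized by arclength; in
  particular they are regular and complete.\<close>

definition arclength_curve_S3 :: "(real \<Rightarrow> real^4) \<Rightarrow> bool"
  where "arclength_curve_S3 \<gamma> \<longleftrightarrow> smooth \<gamma> \<and>
    (\<forall>s. \<gamma> s \<in> S3 \<and> norm (vector_derivative \<gamma> (at s)) = 1)"

text \<open>The condition \<open>\<kappa> s > 0\<close> is what makes the principal normal and the torsion well defined: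
  along a great circle, for instance, the Frenet--Serret equations hold with \<open>\<kappa> = 0\<close> and an
  arbitrary function \<open>\<tau>\<close>. The orientation of the frame is not fixed, so \<open>b\<close> and \<open>\<tau>\<close> are
  determined by \<open>\<gamma>\<close> up to a common sign, and the absolute value of \<open>\<tau>\<close> is determined.\<close>

definition frenet_apparatus ::
  "(real \<Rightarrow> real^4) \<Rightarrow> (real \<Rightarrow> real^4) \<Rightarrow> (real \<Rightarrow> real^4) \<Rightarrow> (real \<Rightarrow> real^4)
    \<Rightarrow> (real \<Rightarrow> real) \<Rightarrow> (real \<Rightarrow> real) \<Rightarrow> bool"
  where "frenet_apparatus \<gamma> e n b \<kappa> \<tau> \<longleftrightarrow> (\<forall>s.
    orthogonal_matrix (vector [\<gamma> s, e s, n s, b s] :: real^4^4) \<and>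
    \<kappa> s > 0 \<and>
    (\<gamma> has_vector_derivative e s) (at s) \<and>
    (e has_vector_derivative (- \<gamma> s + \<kappa> s *\<^sub>R n s)) (at s) \<and>
    (n has_vector_derivative (- (\<kappa> s *\<^sub>R e s) + \<tau> s *\<^sub>R b s)) (at s) \<and>
    (b has_vector_derivative (- (\<tau> s *\<^sub>R n s))) (at s))"

text \<open>The circle parameter \<open>t\<close> is represented by a real number; the maps below are periodic
  in it with period \<open>2 * pi\<close>.\<close>

definition ruled :: "(real \<Rightarrow> real^4) \<Rightarrow> (real \<Rightarrow> real^4) \<Rightarrow> real \<Rightarrow> real \<Rightarrow> real^4"
  where "ruled p v s t = cos t *\<^sub>R p s + sin t *\<^sub>R v s"

definition developable_tube :: "(real \<Rightarrow> real^4) \<Rightarrow> (real \<Rightarrow> real \<Rightarrow> real^4) \<Rightarrow> bool"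
  where "developable_tube \<gamma> f \<longleftrightarrow> (\<exists>e1 e2. smooth e1 \<and> smooth e2 \<and>
    (\<forall>s. norm (e1 s) = 1 \<and> norm (e2 s) = 1 \<and> e1 s \<bullet> e2 s = 0 \<and>
      span {e1 s, e2 s} = orthogonal_comp (span {\<gamma> s, vector_derivative \<gamma> (at s)})) \<and>
    f = ruled e1 e2)"

text \<open>The dual is determined by \<open>f\<close> only up to a rotation of the frame \<open>(q, w)\<close> of each ruling,
  that is, up to \<open>(s, t) \<mapsto> (s, t + \<phi> s)\<close>; hence a relation.\<close>

definition dual_of :: "(real \<Rightarrow> real \<Rightarrow> real^4) \<Rightarrow> (real \<Rightarrow> real \<Rightarrow> real^4) \<Rightarrow> bool"
  where "dual_of f g \<longleftrightarrow> (\<exists>p v q w. smooth p \<and> smooth v \<and> smooth q \<and> smooth w \<and>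
    (\<forall>s. rotation_matrix (vector [p s, v s, q s, w s] :: real^4^4)) \<and>
    f = ruled p v \<and> g = ruled q w)"

text \<open>Here \<open>arccos (x \<bullet> y)\<close> is the geodesic distance of the unit sphere.\<close>

definition isometry_S3 :: "(real^4 \<Rightarrow> real^4) \<Rightarrow> bool"
  where "isometry_S3 T \<longleftrightarrow> bij_betw T S3 S3 \<and>
    (\<forall>x\<in>S3. \<forall>y\<in>S3. arccos (T x \<bullet> T y) = arccos (x \<bullet> y))"

text \<open>Congruence of ruled surfaces: an isometry carries the ruling of \<open>f\<close> at parameter \<open>s\<close> to
  the ruling of \<open>g\<close> at the same parameter \<open>s\<close>. Along the rulings, which are great circles
  parametrized by arclength, the origin and the direction of the parameter \<open>t\<close> may change.
  Reparametrizations of \<open>s\<close> are not allowed. With them, developable tubes of curves of nonconstant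
  torsion can become self-dual: if \<open>\<sigma>\<close> is a decreasing smooth involution of the real line with
  nonvanishing derivative and \<open>\<gamma>\<close> has torsion \<open>\<bar>\<sigma>'\<bar>\<close> and curvature \<open>sqrt \<bar>\<sigma>'\<bar>\<close>, then
  the binormal \<open>b\<close> of \<open>\<gamma>\<close> and the curve \<open>\<gamma> \<circ> \<sigma>\<close> are congruent, and so are the
  developable tube of \<open>\<gamma>\<close> and its dual after the substitution \<open>s \<mapsto> \<sigma> s\<close>.\<close>

definition congruent_ruled :: "(real \<Rightarrow> real \<Rightarrow> real^4) \<Rightarrow> (real \<Rightarrow> real \<Rightarrow> real^4) \<Rightarrow> bool"
  where "congruent_ruled f g \<longleftrightarrow> (\<exists>T \<epsilon> \<phi>. isometry_S3 T \<and> \<epsilon> \<in> {1, -1} \<and> smooth \<phi> \<and>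
    (\<forall>s t. T (f s t) = g s (\<epsilon> * t + \<phi> s)))"

definition self_dual :: "(real \<Rightarrow> real \<Rightarrow> real^4) \<Rightarrow> bool"
  where "self_dual f \<longleftrightarrow> (\<exists>g. dual_of f g \<and> congruent_ruled f g)"

end

theory Submission
  imports Defs
begin

text \<open>The rulings of the tube and of its dual span the planes \<open>{n, b}\<close> and \<open>{\<gamma>, e}\<close>. A congruence
  extends to an orthogonal map \<open>L\<close> exchanging these planes. Differentiating along the curve gives
  \<open>L b = \<plusminus>\<gamma>\<close> and \<open>L n = \<plusminus>e\<close>, and comparing \<open>b' = -\<tau> n\<close> with \<open>\<gamma>' = e\<close> gives \<open>\<bar>\<tau>\<bar> = 1\<close>.
  Conversely, if \<open>\<bar>\<tau>\<bar> = 1\<close> then \<open>\<tau>\<close> is constant by continuity, and by the Frenet--Serret equations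
  the orthogonal map \<open>\<gamma> \<mapsto> -b\<close>, \<open>e \<mapsto> \<tau> n\<close>, \<open>n \<mapsto> -\<tau> e\<close>, \<open>b \<mapsto> \<gamma>\<close> does not depend on \<open>s\<close>.\<close>

section \<open>Orthonormal frames as rows of orthogonal matrices\<close>

lemma vector_4:
  "(vector [a, b, c, d] :: 'a::zero^4) $ 1 = a"
  "(vector [a, b, c, d] :: 'a::zero^4) $ 2 = b"
  "(vector [a, b, c, d] :: 'a::zero^4) $ 3 = c"
  "(vector [a, b, c, d] :: 'a::zero^4) $ 4 = d"
  unfolding vector_def by simp_all

text \<open>For a square matrix a left inverse is a right inverse, so
  \<open>A ** transpose A = mat 1\<close> decides orthogonality; its entries are the inner products
  of the rows.\<close>

lemma orthogonal_matrix_inner_rows: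
  fixes A :: "real^'n^'n"
  shows "orthogonal_matrix A \<longleftrightarrow> (\<forall>i j. A $ i \<bullet> A $ j = (if i = j then 1 else 0))"
proof -
  have "orthogonal_matrix A \<longleftrightarrow> A ** transpose A = mat 1"
    by (metis matrix_left_right_inverse orthogonal_matrix_def)
  also have "\<dots> \<longleftrightarrow> (\<forall>i j. A $ i \<bullet> A $ j = (if i = j then 1 else 0))"
    by (simp add: vec_eq_iff matrix_matrix_mult_def transpose_def mat_def inner_vec_def)
  finally show ?thesis .
qed

text \<open>Applying \<open>transpose A ** A = mat 1\<close> to \<open>x\<close> gives the expansion
  in the orthonormal basis of rows.\<close>

lemma orthogonal_matrix_row_expansion:
  fixes A :: "real^'n^'n"
  assumes "orthogonal_matrix A"
  shows "(\<Sum>i\<in>UNIV. (A $ i \<bullet> x) *\<^sub>R A $ i) = x"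
proof -
  have "transpose A *v (A *v x) = x"
    using assms by (simp add: matrix_vector_mul_assoc orthogonal_matrix_def)
  moreover have "transpose A *v (A *v x) = (\<Sum>i\<in>UNIV. (A $ i \<bullet> x) *\<^sub>R A $ i)"
    by (simp add: vec_eq_iff matrix_vector_mult_def transpose_def inner_vec_def mult.commute)
  ultimately show ?thesis by simp
qed

lemma orthogonal_matrix_vector_4:
  fixes a b c d :: "real^4"
  shows "orthogonal_matrix (vector [a, b, c, d] :: real^4^4) \<longleftrightarrow>
    a \<bullet> a = 1 \<and> b \<bullet> b = 1 \<and> c \<bullet> c = 1 \<and> d \<bullet> d = 1 \<and>
    a \<bullet> b = 0 \<and> a \<bullet> c = 0 \<and> a \<bullet> d = 0 \<and> b \<bullet> c = 0 \<and> b \<bullet> d = 0 \<and> c \<bullet> d = 0"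
  unfolding orthogonal_matrix_inner_rows by (auto simp: forall_4 vector_4 inner_commute)

lemma orthonormal_expansion_4:
  fixes a b c d :: "real^4"
  assumes "orthogonal_matrix (vector [a, b, c, d] :: real^4^4)"
  shows "x = (a \<bullet> x) *\<^sub>R a + (b \<bullet> x) *\<^sub>R b + (c \<bullet> x) *\<^sub>R c + (d \<bullet> x) *\<^sub>R d"
  using orthogonal_matrix_row_expansion[OF assms, of x] by (simp add: sum_4 vector_4)

section \<open>Continuity and smoothness\<close>

lemma continuous_on_det:
  fixes A :: "'a::topological_space \<Rightarrow> real^'n^'n"
  assumes "\<And>i. continuous_on S (\<lambda>s. A s $ i)"
  shows "continuous_on S (\<lambda>s. det (A s))"
  unfolding det_def
  by (rule continuous_on_sum continuous_on_mult continuous_on_prod continuous_on_const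
      continuous_on_component assms)+

text \<open>On the connected real line a continuous function with finite range is constant. This
  serves both the torsion and the determinant of the frame of the dual.\<close>

lemma continuous_abs_eq_1_constant:
  fixes g :: "real \<Rightarrow> real"
  assumes "continuous_on UNIV g" "\<And>s. \<bar>g s\<bar> = 1"
  obtains c where "\<bar>c\<bar> = 1" "\<And>s. g s = c"
proof -
  have "range g \<subseteq> {1, -1}"
    using assms(2) by (auto simp: abs_if split: if_splits) (metis minus_minus)
  then have "finite (range g)"
    by (rule finite_subset) simp
  then have "g constant_on UNIV"
    by (intro continuous_finite_range_constant assms(1)) simp_all
  then show thesis
    using that assms(2) unfolding constant_on_def by (metis UNIV_I)
qed

text \<open>A bounded linear map commutes with every iterated derivative. The frame of the dual is
  built as a linear image of the frame of the tube.\<close>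

lemma smooth_bounded_linear:
  assumes "bounded_linear L" "smooth c"
  shows "smooth (\<lambda>s. L (c s))"
proof -
  let ?D = "\<lambda>g u. vector_derivative g (at u)"
  have eq: "(?D ^^ k) (\<lambda>s. L (c s)) = (\<lambda>s. L ((?D ^^ k) c s))" for k
  proof (induction k)
    case (Suc k)
    have "((\<lambda>s. L ((?D ^^ k) c s)) has_vector_derivative L (?D ((?D ^^ k) c) s)) (at s)" for s
      using assms(2) unfolding smooth_def
      by (intro bounded_linear.has_vector_derivative[OF assms(1)])
        (simp add: vector_derivative_works)
    then show ?case
      using Suc by (auto simp: vector_derivative_at)
  qed simp
  have "(\<lambda>s. L ((?D ^^ k) c s)) differentiable (at s)" for k s
    using assms(2) unfolding smooth_def
    by (blast intro: differentiable_compose[of L] bounded_linear_imp_differentiable[OF assms(1)])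
  then show ?thesis
    unfolding smooth_def eq by blast
qed

lemma smooth_continuous: "smooth c \<Longrightarrow> continuous_on S c"
  unfolding smooth_def
  by (metis continuous_at_imp_continuous_on differentiable_imp_continuous_within funpow_0)

lemma smooth_zero: "smooth (\<lambda>s. 0)"
proof -
  have "((\<lambda>g u. vector_derivative g (at u)) ^^ k) (\<lambda>s. 0 :: 'a) = (\<lambda>s. 0)" for k
    by (induction k) auto
  then show ?thesis
    unfolding smooth_def by simp
qed

section \<open>Isometries of the sphere and orthogonal maps\<close>

text \<open>Since \<open>arccos\<close> is injective on [-1, 1], equal geodesic distances give equal
  inner products, hence equal chordal distances; such a map of the unit sphere extends to an
  orthogonal map.\<close>

lemma isometry_S3_extend:
  assumes "isometry_S3 T"
  obtains L where "orthogonal_transformation L" "\<And>x. x \<in> S3 \<Longrightarrow> L x = T x"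
proof -
  have T: "norm (T x) = 1" if "norm x = 1" for x
    using assms that bij_betwE[of T S3 S3] unfolding isometry_S3_def by auto
  have inner: "T x \<bullet> T y = x \<bullet> y" if "norm x = 1" "norm y = 1" for x y
  proof (rule arccos_eq_iff[THEN iffD1])
    show "\<bar>T x \<bullet> T y\<bar> \<le> 1 \<and> \<bar>x \<bullet> y\<bar> \<le> 1"
      using Cauchy_Schwarz_ineq2[of x y] Cauchy_Schwarz_ineq2[of "T x" "T y"] T that by simp
    show "arccos (T x \<bullet> T y) = arccos (x \<bullet> y)"
      using assms that unfolding isometry_S3_def by simp
  qed
  have "dist (T x) (T y) = dist x y" if "norm x = 1" "norm y = 1" for x y
    using that inner T
    by (simp add: dist_norm norm_eq_sqrt_inner inner_diff_left inner_diff_right)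
  then show thesis
    using isometry_sphere_extend[of T] T that by auto
qed

lemma orthogonal_transformation_isometry_S3:
  assumes "orthogonal_transformation L"
  shows "isometry_S3 L"
proof -
  have "L ` S3 = S3"
  proof
    show "L ` S3 \<subseteq> S3"
      using assms by (auto simp: orthogonal_transformation)
    show "S3 \<subseteq> L ` S3"
    proof
      fix y assume "y \<in> S3"
      moreover obtain x where "y = L x"
        using orthogonal_transformation_surj[OF assms] by (metis surjD)
      ultimately show "y \<in> L ` S3"
        using assms by (auto simp: orthogonal_transformation)
    qed
  qed
  moreover have "inj_on L S3"
    using orthogonal_transformation_inj[OF assms] inj_on_subset by blast
  ultimately show ?thesis
    using assms unfolding isometry_S3_def bij_betw_def orthogonal_transformation_def by auto
qed

section \<open>The Frenet frame and the ruling planes of the tube\<close>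

lemma inner_has_vector_derivative:
  assumes "(f has_vector_derivative f') (at s)" "(g has_vector_derivative g') (at s)"
  shows "((\<lambda>s. f s \<bullet> g s) has_real_derivative f s \<bullet> g' + f' \<bullet> g s) (at s)"
  using bounded_bilinear.has_vector_derivative[OF bounded_bilinear_inner assms]
  by (simp add: has_real_derivative_iff_has_vector_derivative)

lemma frenet_apparatus_inner:
  assumes "frenet_apparatus \<gamma> e n b \<kappa> \<tau>"
  shows "\<gamma> s \<bullet> \<gamma> s = 1" "e s \<bullet> e s = 1" "n s \<bullet> n s = 1" "b s \<bullet> b s = 1"
    "\<gamma> s \<bullet> e s = 0" "\<gamma> s \<bullet> n s = 0" "\<gamma> s \<bullet> b s = 0"
    "e s \<bullet> n s = 0" "e s \<bullet> b s = 0" "n s \<bullet> b s = 0"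
    "e s \<bullet> \<gamma> s = 0" "n s \<bullet> \<gamma> s = 0" "b s \<bullet> \<gamma> s = 0"
    "n s \<bullet> e s = 0" "b s \<bullet> e s = 0" "b s \<bullet> n s = 0"
  using assms unfolding frenet_apparatus_def orthogonal_matrix_vector_4
  by (auto simp: inner_commute)

lemma frenet_apparatus_expansion:
  assumes "frenet_apparatus \<gamma> e n b \<kappa> \<tau>"
  shows "x = (\<gamma> s \<bullet> x) *\<^sub>R \<gamma> s + (e s \<bullet> x) *\<^sub>R e s + (n s \<bullet> x) *\<^sub>R n s + (b s \<bullet> x) *\<^sub>R b s"
  using assms unfolding frenet_apparatus_def by (blast intro: orthonormal_expansion_4)

lemma frenet_apparatus_derivatives:
  assumes "frenet_apparatus \<gamma> e n b \<kappa> \<tau>"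
  shows "(\<gamma> has_vector_derivative e s) (at s)"
    "(e has_vector_derivative (- \<gamma> s + \<kappa> s *\<^sub>R n s)) (at s)"
    "(n has_vector_derivative (- (\<kappa> s *\<^sub>R e s) + \<tau> s *\<^sub>R b s)) (at s)"
    "(b has_vector_derivative (- (\<tau> s *\<^sub>R n s))) (at s)"
  using assms unfolding frenet_apparatus_def by auto

text \<open>The frame \<open>e1, e2\<close> of a tube may be rotated against \<open>n, b\<close>;
  only the common plane matters. Membership in it is tested against the two generators
  \<open>\<gamma> s\<close> and \<open>e s\<close>.\<close>

lemma frenet_apparatus_tube_span:
  assumes F: "frenet_apparatus \<gamma> e n b \<kappa> \<tau>"
    and sp: "span {e1, e2} = orthogonal_comp (span {\<gamma> s, vector_derivative \<gamma> (at s)})"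
  shows "n s \<in> span {e1, e2}" "b s \<in> span {e1, e2}"
    "\<gamma> s \<bullet> e1 = 0" "\<gamma> s \<bullet> e2 = 0" "e s \<bullet> e1 = 0" "e s \<bullet> e2 = 0"
proof -
  have vd: "vector_derivative \<gamma> (at s) = e s"
    using frenet_apparatus_derivatives(1)[OF F] by (rule vector_derivative_at)
  have mem: "x \<in> span {e1, e2} \<longleftrightarrow> \<gamma> s \<bullet> x = 0 \<and> e s \<bullet> x = 0" for x
  proof
    show "\<gamma> s \<bullet> x = 0 \<and> e s \<bullet> x = 0" if "x \<in> span {e1, e2}"
      using that unfolding sp vd orthogonal_comp_def orthogonal_def
      by (auto simp: span_base)
    show "x \<in> span {e1, e2}" if x: "\<gamma> s \<bullet> x = 0 \<and> e s \<bullet> x = 0"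
    proof -
      have "orthogonal x y" if "y \<in> span {\<gamma> s, e s}" for y
        using that by (rule orthogonal_to_span) (use x in \<open>auto simp: orthogonal_def inner_commute\<close>)
      then show ?thesis
        unfolding sp vd orthogonal_comp_def by (simp add: orthogonal_commute)
    qed
  qed
  show "n s \<in> span {e1, e2}" "b s \<in> span {e1, e2}"
    by (simp_all add: mem frenet_apparatus_inner[OF F])
  show "\<gamma> s \<bullet> e1 = 0" "\<gamma> s \<bullet> e2 = 0" "e s \<bullet> e1 = 0" "e s \<bullet> e2 = 0"
    using mem[of e1] mem[of e2] by (simp_all add: span_base)
qed

text \<open>The torsion is recovered as a quotient of continuous functions, from
  \<open>\<gamma>''' \<bullet> b = \<kappa> * \<tau>\<close> and
  \<open>\<gamma>'' \<bullet> n = \<kappa>\<close> with \<open>\<kappa> > 0\<close>.\<close>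

lemma frenet_apparatus_torsion_continuous:
  assumes "smooth \<gamma>" and F: "frenet_apparatus \<gamma> e n b \<kappa> \<tau>"
  shows "continuous_on UNIV \<tau>"
proof -
  note D = frenet_apparatus_derivatives[OF F] and I = frenet_apparatus_inner[OF F]
  \<comment> \<open>The acceleration is kept as one vector: it is differentiable because
    \<open>\<gamma>\<close> is smooth, while nothing is given about differentiability of
    \<open>\<kappa>\<close>.\<close>
  define a where "a = (\<lambda>s. - \<gamma> s + \<kappa> s *\<^sub>R n s)"
  define a' where "a' = (\<lambda>s. vector_derivative a (at s))"
  let ?D = "\<lambda>g u. vector_derivative g (at u)"
  have "?D \<gamma> = e" "?D e = a"
    using D(1,2) by (auto simp: a_def vector_derivative_at)
  then have "(?D ^^ 2) \<gamma> = a" "(?D ^^ 3) \<gamma> = a'"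
    by (simp_all add: numeral_eq_Suc a'_def)
  then have diff: "a differentiable (at s)" "a' differentiable (at s)" for s
    using assms(1) unfolding smooth_def by metis+
  have a': "(a has_vector_derivative a' s) (at s)" for s
    using diff(1) unfolding a'_def by (simp add: vector_derivative_works)
  have cont: "continuous_on UNIV a'" "continuous_on UNIV b" "continuous_on UNIV n" "continuous_on UNIV a"
    using diff D(3,4)[THEN has_vector_derivative_continuous]
    by (simp_all add: continuous_at_imp_continuous_on differentiable_imp_continuous_within)
  have \<kappa>: "\<kappa> s = a s \<bullet> n s" "\<kappa> s \<noteq> 0" for s
    using F unfolding frenet_apparatus_def
    by (simp_all add: a_def inner_diff_left I) (metis less_irrefl)
  \<comment> \<open>Since \<open>a\<close> has no \<open>b\<close> component, differentiate
    \<open>a \<bullet> b = 0\<close> and insert \<open>b' = -\<tau> n\<close>.\<close>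
  have "a' s \<bullet> b s = \<kappa> s * \<tau> s" for s
  proof -
    have "((\<lambda>s. a s \<bullet> b s) has_real_derivative a s \<bullet> - (\<tau> s *\<^sub>R n s) + a' s \<bullet> b s) (at s)"
      by (rule inner_has_vector_derivative[OF a' D(4)])
    moreover have "(\<lambda>s. a s \<bullet> b s) = (\<lambda>s. 0)"
      by (simp add: a_def inner_diff_left I)
    ultimately have "a s \<bullet> - (\<tau> s *\<^sub>R n s) + a' s \<bullet> b s = 0"
      using DERIV_const DERIV_unique by metis
    then show ?thesis
      using \<kappa>(1)[of s] by simp
  qed
  then have "\<tau> = (\<lambda>s. (a' s \<bullet> b s) / (a s \<bullet> n s))"
    using \<kappa> by (auto simp: fun_eq_iff)
  moreover have "continuous_on UNIV (\<lambda>s. (a' s \<bullet> b s) / (a s \<bullet> n s))"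
    using \<kappa> by (intro continuous_intros cont) metis
  ultimately show ?thesis by simp
qed

section \<open>Self-duality forces torsion of absolute value one\<close>

lemma self_dual_imp_abs_torsion_eq_1:
  assumes F: "frenet_apparatus \<gamma> e n b \<kappa> \<tau>"
    and "developable_tube \<gamma> f" "self_dual f"
  shows "\<bar>\<tau> s\<bar> = 1"
proof -
  note D = frenet_apparatus_derivatives[OF F] and I = frenet_apparatus_inner[OF F]
  obtain e1 e2 where f: "f = ruled e1 e2" and e12: "\<And>s. norm (e1 s) = 1" "\<And>s. norm (e2 s) = 1"
    and sp: "\<And>s. span {e1 s, e2 s} = orthogonal_comp (span {\<gamma> s, vector_derivative \<gamma> (at s)})"
    using assms(2) unfolding developable_tube_def by blast
  obtain g p v q w T \<epsilon> \<phi> where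
    frame: "\<And>s. rotation_matrix (vector [p s, v s, q s, w s] :: real^4^4)"
    and pv: "f = ruled p v" and g: "g = ruled q w"
    and T: "isometry_S3 T" and Tf: "\<And>s t. T (f s t) = g s (\<epsilon> * t + \<phi> s)"
    using assms(3) unfolding self_dual_def dual_of_def congruent_ruled_def by blast
  have ruled_ends: "ruled x y s 0 = x s" "ruled x y s (pi / 2) = y s" for x y s
    by (simp_all add: ruled_def)
  \<comment> \<open>The values at \<open>t = 0\<close> and \<open>t = pi / 2\<close> recover a frame
    from its ruled map, so the frame completed by \<open>q, w\<close> is the tube's own
    \<open>e1, e2\<close>.\<close>
  have pv': "p s = e1 s" "v s = e2 s" for s
    using ruled_ends f pv by metis+
  obtain L where L: "orthogonal_transformation L" and LT: "\<And>x. x \<in> S3 \<Longrightarrow> L x = T x"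
    using isometry_S3_extend[OF T] by blast
  have lin: "linear L" and L_inner: "\<And>x y. L x \<bullet> L y = x \<bullet> y"
    using L by (auto simp: orthogonal_transformation_def)
  have Le: "L (e1 s) = ruled q w s (\<phi> s)" "L (e2 s) = ruled q w s (\<epsilon> * (pi / 2) + \<phi> s)" for s
    using Tf[of s 0] Tf[of s "pi / 2"] LT e12 by (simp_all add: f g ruled_ends)
  \<comment> \<open>The sign \<open>\<epsilon>\<close> and the shift \<open>\<phi>\<close> only move
    points along the dual ruling, so orthogonality for every \<open>t\<close> absorbs them.\<close>
  have perp: "x \<bullet> ruled q w s t = 0" if "x \<in> {e1 s, e2 s}" for x s t
    using frame[of s] that unfolding rotation_matrix_def orthogonal_matrix_vector_4 pv'
    by (auto simp: ruled_def inner_add_right)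
  \<comment> \<open>Orthogonality on generators spreads to the whole plane, so \<open>e1, e2\<close>
    can be replaced by \<open>n, b\<close>, whose derivatives are known.\<close>
  have L_perp: "x \<bullet> L y = 0" if "x \<in> span {e1 s, e2 s}" "y \<in> span {e1 s, e2 s}" for x y s
  proof -
    have "orthogonal (L y') x" if "y' \<in> {e1 s, e2 s}" for y'
      using \<open>x \<in> span {e1 s, e2 s}\<close>
      by (rule orthogonal_to_span) (use that perp Le in \<open>auto simp: orthogonal_def inner_commute\<close>)
    moreover have "L y \<in> span (L ` {e1 s, e2 s})"
      using that(2) span_linear_image[OF lin] by blast
    ultimately have "orthogonal x (L y)"
      by (auto intro: orthogonal_to_span simp: orthogonal_commute)
    then show ?thesis by (simp add: orthogonal_def)
  qed
  have L_perp': "n s \<bullet> L (n s) = 0" "n s \<bullet> L (b s) = 0" "b s \<bullet> L (n s) = 0" "b s \<bullet> L (b s) = 0" for s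
    using frenet_apparatus_tube_span(1,2)[OF F sp] L_perp by metis+
  have D_L: "((\<lambda>s. L (b s)) has_vector_derivative L (- (\<tau> s *\<^sub>R n s))) (at s)" for s
    by (intro bounded_linear.has_vector_derivative[of L] D linear_conv_bounded_linear[THEN iffD1] lin)
  have L_scale: "L (- (\<tau> s *\<^sub>R n s)) = - (\<tau> s *\<^sub>R L (n s))" for s
    using lin by (simp add: linear_neg linear_scale)
  text \<open>Differentiating \<open>n \<bullet> L b = 0\<close> and \<open>b \<bullet> L b = 0\<close> shows that \<open>L b\<close> is a multiple of \<open>\<gamma>\<close>;
    differentiating \<open>e \<bullet> L b = 0\<close> then relates the length of \<open>\<tau> *\<^sub>R L n\<close> to that of \<open>L b\<close>.\<close>
  have eLb: "e s \<bullet> L (b s) = 0" for s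
  proof -
    have "((\<lambda>s. n s \<bullet> L (b s)) has_real_derivative
        n s \<bullet> L (- (\<tau> s *\<^sub>R n s)) + (- (\<kappa> s *\<^sub>R e s) + \<tau> s *\<^sub>R b s) \<bullet> L (b s)) (at s)"
      by (rule inner_has_vector_derivative[OF D(3) D_L])
    then have "n s \<bullet> L (- (\<tau> s *\<^sub>R n s)) + (- (\<kappa> s *\<^sub>R e s) + \<tau> s *\<^sub>R b s) \<bullet> L (b s) = 0"
      unfolding L_perp' using DERIV_const DERIV_unique by metis
    \<comment> \<open>All other terms vanish by \<open>L_perp'\<close>; positivity of
      \<open>\<kappa>\<close> then removes the factor.\<close>
    then have "\<kappa> s * (e s \<bullet> L (b s)) = 0"
      by (simp add: L_scale L_perp' inner_diff_left)
    then show ?thesis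
      using F unfolding frenet_apparatus_def by (metis less_irrefl mult_eq_0_iff)
  qed
  have "((\<lambda>s. e s \<bullet> L (b s)) has_real_derivative
      e s \<bullet> L (- (\<tau> s *\<^sub>R n s)) + (- \<gamma> s + \<kappa> s *\<^sub>R n s) \<bullet> L (b s)) (at s)"
    by (rule inner_has_vector_derivative[OF D(2) D_L])
  then have "e s \<bullet> L (- (\<tau> s *\<^sub>R n s)) + (- \<gamma> s + \<kappa> s *\<^sub>R n s) \<bullet> L (b s) = 0"
    unfolding eLb using DERIV_const DERIV_unique by metis
  then have \<gamma>Lb: "\<gamma> s \<bullet> L (b s) = - (\<tau> s * (e s \<bullet> L (n s)))"
    by (simp add: L_scale L_perp' inner_diff_left)
  have Lb: "L (b s) = (\<gamma> s \<bullet> L (b s)) *\<^sub>R \<gamma> s"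
    using frenet_apparatus_expansion[OF F, of "L (b s)" s] by (simp add: L_perp' eLb)
  then have "L (b s) \<bullet> L (b s) = (\<gamma> s \<bullet> L (b s))\<^sup>2"
    by (metis I(1) inner_commute inner_scaleR_left inner_scaleR_right mult.right_neutral power2_eq_square)
  then have sq: "(\<gamma> s \<bullet> L (b s))\<^sup>2 = 1"
    by (simp add: L_inner I)
  \<comment> \<open>As \<open>L (b s)\<close> is \<open>\<gamma> s\<close> up to sign, this kills
    the \<open>\<gamma>\<close> component of \<open>L (n s)\<close> and leaves only the
    \<open>e\<close> component.\<close>
  have "L (b s) \<bullet> L (n s) = 0"
    by (simp add: L_inner I)
  then have "\<gamma> s \<bullet> L (n s) = 0"
    using Lb sq by (metis inner_scaleR_left mult_eq_0_iff power_zero_numeral zero_neq_one)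
  then have Ln: "L (n s) = (e s \<bullet> L (n s)) *\<^sub>R e s"
    using frenet_apparatus_expansion[OF F, of "L (n s)" s] by (simp add: L_perp')
  then have "L (n s) \<bullet> L (n s) = (e s \<bullet> L (n s))\<^sup>2"
    by (metis I(2) inner_commute inner_scaleR_left inner_scaleR_right mult.right_neutral power2_eq_square)
  then have "(e s \<bullet> L (n s))\<^sup>2 = 1"
    by (simp add: L_inner I)
  then have "(\<tau> s)\<^sup>2 = 1"
    using sq by (simp add: \<gamma>Lb power_mult_distrib)
  then show ?thesis
    by (simp add: abs_square_eq_1)
qed

section \<open>Torsion of absolute value one gives a congruence with a dual\<close>

lemma abs_torsion_eq_1_imp_self_dual:
  assumes \<gamma>: "arclength_curve_S3 \<gamma>" and F: "frenet_apparatus \<gamma> e n b \<kappa> \<tau>"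
    and tube: "developable_tube \<gamma> f" and \<tau>: "\<And>s. \<bar>\<tau> s\<bar> = 1"
  shows "self_dual f"
proof -
  note D = frenet_apparatus_derivatives[OF F] and I = frenet_apparatus_inner[OF F]
  obtain e1 e2 where f: "f = ruled e1 e2" and sm: "smooth e1" "smooth e2"
    and e12: "\<And>s. norm (e1 s) = 1" "\<And>s. norm (e2 s) = 1" "\<And>s. e1 s \<bullet> e2 s = 0"
    and sp: "\<And>s. span {e1 s, e2 s} = orthogonal_comp (span {\<gamma> s, vector_derivative \<gamma> (at s)})"
    using tube unfolding developable_tube_def by blast
  have "continuous_on UNIV \<tau>"
    using frenet_apparatus_torsion_continuous \<gamma> F unfolding arclength_curve_S3_def by blast
  then obtain c where c1: "\<bar>c\<bar> = 1" and c: "\<And>s. \<tau> s = c"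
    using continuous_abs_eq_1_constant \<tau> by metis
  have c_cases: "c = 1 \<or> c = -1" using c1 by linarith
  then have cc: "c * c = 1" by auto
  \<comment> \<open>The signs are chosen to be compatible with the Frenet equations:
    \<open>M s\<close> sends the derivative of each frame vector to the derivative of the image of
    that vector.\<close>
  define M where "M = (\<lambda>s x. - ((\<gamma> s \<bullet> x) *\<^sub>R b s) + (c * (e s \<bullet> x)) *\<^sub>R n s
    - (c * (n s \<bullet> x)) *\<^sub>R e s + (b s \<bullet> x) *\<^sub>R \<gamma> s)"
  have M_deriv: "((\<lambda>s. M s x) has_vector_derivative 0) (at s)" for s x
  proof -
    have D': "((\<lambda>s. \<gamma> s \<bullet> x) has_real_derivative e s \<bullet> x) (at s)"
      "((\<lambda>s. e s \<bullet> x) has_real_derivative (- \<gamma> s + \<kappa> s *\<^sub>R n s) \<bullet> x) (at s)"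
      "((\<lambda>s. n s \<bullet> x) has_real_derivative (- (\<kappa> s *\<^sub>R e s) + c *\<^sub>R b s) \<bullet> x) (at s)"
      "((\<lambda>s. b s \<bullet> x) has_real_derivative (- (c *\<^sub>R n s)) \<bullet> x) (at s)"
      using D[THEN inner_has_vector_derivative, OF has_vector_derivative_const[of x]]
      by (simp_all add: c)
    have "((\<lambda>s. M s x) has_vector_derivative
        - ((\<gamma> s \<bullet> x) *\<^sub>R - (c *\<^sub>R n s) + (e s \<bullet> x) *\<^sub>R b s)
        + ((c * (e s \<bullet> x)) *\<^sub>R (- (\<kappa> s *\<^sub>R e s) + c *\<^sub>R b s)
          + (c * ((- \<gamma> s + \<kappa> s *\<^sub>R n s) \<bullet> x)) *\<^sub>R n s)
        - ((c * (n s \<bullet> x)) *\<^sub>R (- \<gamma> s + \<kappa> s *\<^sub>R n s)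
          + (c * ((- (\<kappa> s *\<^sub>R e s) + c *\<^sub>R b s) \<bullet> x)) *\<^sub>R e s)
        + ((b s \<bullet> x) *\<^sub>R e s + (- (c *\<^sub>R n s) \<bullet> x) *\<^sub>R \<gamma> s)) (at s)"
      unfolding M_def
      by (rule has_vector_derivative_add has_vector_derivative_diff has_vector_derivative_minus
          has_vector_derivative_scaleR DERIV_cmult D' D[unfolded c])+
    \<comment> \<open>The terms cancel in pairs, two of the pairs because
      \<open>c * c = 1\<close>.\<close>
    then show ?thesis
      using c_cases by (auto simp: inner_add_left inner_diff_left algebra_simps)
  qed
  define L where "L = M 0"
  have M: "M s x = L x" for s x
  proof -
    obtain z where "M s x = z" for s
      using has_derivative_zero_constant[of UNIV "\<lambda>s. M s x"] M_deriv[of x]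
      by (auto simp: has_vector_derivative_def)
    then show ?thesis unfolding L_def by metis
  qed
  have L_inner: "L x \<bullet> L y = x \<bullet> y" for x y
  proof -
    have "x \<bullet> y = (\<gamma> 0 \<bullet> x) * (\<gamma> 0 \<bullet> y) + (e 0 \<bullet> x) * (e 0 \<bullet> y) + (n 0 \<bullet> x) * (n 0 \<bullet> y)
        + (b 0 \<bullet> x) * (b 0 \<bullet> y)"
      using arg_cong[OF frenet_apparatus_expansion[OF F, of x 0], of "\<lambda>z. z \<bullet> y"]
      by (simp add: inner_add_left)
    moreover have "L x \<bullet> L y = (\<gamma> 0 \<bullet> x) * (\<gamma> 0 \<bullet> y) + (c * c) * ((e 0 \<bullet> x) * (e 0 \<bullet> y))
        + (c * c) * ((n 0 \<bullet> x) * (n 0 \<bullet> y)) + (b 0 \<bullet> x) * (b 0 \<bullet> y)"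
      unfolding L_def M_def
      by (simp add: inner_add_left inner_add_right inner_diff_left inner_diff_right I)
    ultimately show ?thesis by (simp add: cc)
  qed
  have "linear L"
    unfolding L_def M_def
    by (intro linearI) (simp_all add: inner_add_right algebra_simps)
  with L_inner have L: "orthogonal_transformation L" and bl: "bounded_linear L"
    by (simp_all add: orthogonal_transformation_def linear_conv_bounded_linear)
  have norm: "e1 s \<bullet> e1 s = 1" "e2 s \<bullet> e2 s = 1" for s
    using e12 by (simp_all add: norm_eq_1)
  \<comment> \<open>Writing \<open>L\<close> as \<open>M s\<close> at the same \<open>s\<close>
    shows that \<open>L\<close> maps \<open>e1 s\<close> and \<open>e2 s\<close>, which have no
    \<open>\<gamma>\<close> or \<open>e\<close> component, into the plane of
    \<open>\<gamma> s\<close> and \<open>e s\<close>.\<close>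
  have perp: "e1 s \<bullet> L (e1 s) = 0" "e1 s \<bullet> L (e2 s) = 0" "e2 s \<bullet> L (e1 s) = 0" "e2 s \<bullet> L (e2 s) = 0"
    for s
    unfolding M[symmetric, of _ s] M_def using frenet_apparatus_tube_span(3-6)[OF F sp, of s]
    by (simp_all add: inner_add_right inner_diff_right inner_commute)
  define A :: "real \<Rightarrow> real^4^4" where "A = (\<lambda>s. vector [e1 s, e2 s, L (e1 s), L (e2 s)])"
  have A: "orthogonal_matrix (A s)" for s
    unfolding A_def orthogonal_matrix_vector_4 by (simp add: norm e12 perp L_inner)
  have "\<bar>det (A s)\<bar> = 1" for s
    using det_orthogonal_matrix[OF A, of s] by (metis abs_minus_cancel abs_one)
  moreover have "continuous_on UNIV (\<lambda>s. A s $ i)" for i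
  proof -
    have "\<forall>i. continuous_on UNIV (\<lambda>s. A s $ i)"
      unfolding forall_4 A_def vector_4
      using sm smooth_bounded_linear[OF bl] smooth_continuous by blast
    then show ?thesis by blast
  qed
  \<comment> \<open>The orientation must be one global sign, because the direction
    \<open>\<epsilon>\<close> in \<open>congruent_ruled\<close> may not depend on
    \<open>s\<close>.\<close>
  ultimately obtain d where d: "\<bar>d\<bar> = 1" "\<And>s. det (A s) = d"
    using continuous_abs_eq_1_constant[OF continuous_on_det] by metis
  then have d_cases: "d = 1 \<or> d = -1" by linarith
  text \<open>The sign \<open>d\<close> makes the frame positively oriented; reversing the direction of \<open>t\<close>
    compensates for it.\<close>
  define g where "g = ruled (\<lambda>s. L (e1 s)) (\<lambda>s. d *\<^sub>R L (e2 s))"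
  have "rotation_matrix (vector [e1 s, e2 s, L (e1 s), d *\<^sub>R L (e2 s)] :: real^4^4)" for s
  proof -
    \<comment> \<open>Scaling the fourth row of \<open>A s\<close> by \<open>d\<close> turns the
      determinant into \<open>d * d = 1\<close>.\<close>
    have "(vector [e1 s, e2 s, L (e1 s), d *\<^sub>R L (e2 s)] :: real^4^4) =
        (\<chi> i. if i = 4 then d *s L (e2 s) else A s $ i)"
      unfolding vec_eq_iff[of "vector _"] by (simp add: forall_4 vector_4 A_def scalar_mult_eq_scaleR)
    moreover have "(\<chi> i. if i = 4 then L (e2 s) else A s $ i) = A s"
      unfolding vec_eq_iff[of _ "A s"] by (simp add: forall_4 A_def vector_4)
    ultimately have "det (vector [e1 s, e2 s, L (e1 s), d *\<^sub>R L (e2 s)] :: real^4^4) = d * det (A s)"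
      by (simp add: det_row_mul)
    moreover have "orthogonal_matrix (vector [e1 s, e2 s, L (e1 s), d *\<^sub>R L (e2 s)] :: real^4^4)"
      using d_cases unfolding orthogonal_matrix_vector_4 by (auto simp: norm e12 perp L_inner)
    ultimately show ?thesis
      using d_cases d(2) by (auto simp: rotation_matrix_def)
  qed
  moreover have "smooth (\<lambda>s. L (e1 s))" "smooth (\<lambda>s. d *\<^sub>R L (e2 s))"
    using sm smooth_bounded_linear[OF bl]
      smooth_bounded_linear[OF bounded_linear_const_scaleR[OF bl]] by blast+
  ultimately have "dual_of f g"
    using sm f unfolding dual_of_def g_def by blast
  \<comment> \<open>Cosine is even and sine is odd, so the two factors \<open>d\<close>
    cancel.\<close>
  moreover have "L (f s t) = g s (d * t + 0)" for s t
    using d_cases \<open>linear L\<close>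
    by (auto simp: f g_def ruled_def linear_add linear_scale)
  then have "congruent_ruled f g"
    unfolding congruent_ruled_def using orthogonal_transformation_isometry_S3[OF L] d_cases smooth_zero
    by (intro exI[of _ L] exI[of _ d] exI[of _ "\<lambda>s. 0"]) auto
  ultimately show ?thesis
    unfolding self_dual_def by blast
qed

theorem theorem4p7:
  fixes \<gamma> e n b :: "real \<Rightarrow> real^4"
    and \<kappa> \<tau> :: "real \<Rightarrow> real"
    and f :: "real \<Rightarrow> real \<Rightarrow> real^4"
  assumes "arclength_curve_S3 \<gamma>"
    and "frenet_apparatus \<gamma> e n b \<kappa> \<tau>"
    and "developable_tube \<gamma> f"
  shows "self_dual f \<longleftrightarrow> (\<forall>s. \<bar>\<tau> s\<bar> = 1)"
  using self_dual_imp_abs_torsion_eq_1 abs_torsion_eq_1_imp_self_dual assms by blast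

end
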